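(* Let $n>1$ be an integer and let $x,y\in\mathbb{R}^n$ be such that the Euclidean distance $|x-y|$ is constructible by means of ruler and compass. Then there exists a finite set $S_{xy}\subseteq\mathbb{R}^n$ containing $x$ and $y$ such that each map $f:S_{xy}\to\mathbb{R}^n$ preserving unit distance preserves the distance between $x$ and $y$, i.e. satisfies $|f(x)-f(y)|=|x-y|$.
   Context: $|\cdot|$ denotes the Euclidean norm on $\mathbb{R}^n$. A map $f:S\to\mathbb{R}^n$ with $S\subseteq\mathbb{R}^n$ preserves unit distance if for all $a,b\in S$, $|a-b|=1$ implies $|f(a)-f(b)|=1$ (no continuity, injectivity or other assumption is made on $f$). A non-negative real number is constructible by means of ruler and compass (starting from a unit segment) if it belongs to the real quadratic closure of $\mathbb{Q}$, that is, to the smallest subfield of $\mathbb{R}$ that contains the square root of each of its non-negative elements. *)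

theory Defs
  imports "HOL-Analysis.Analysis"
begin

definition real_subfield :: "real set \<Rightarrow> bool" where
  "real_subfield K \<longleftrightarrow>
     0 \<in> K \<and> 1 \<in> K \<and>
     (\<forall>a\<in>K. \<forall>b\<in>K. a + b \<in> K) \<and>
     (\<forall>a\<in>K. - a \<in> K) \<and>
     (\<forall>a\<in>K. \<forall>b\<in>K. a * b \<in> K) \<and>
     (\<forall>a\<in>K. a \<noteq> 0 \<longrightarrow> inverse a \<in> K)"

definition sqrt_closed :: "real set \<Rightarrow> bool" where
  "sqrt_closed K \<longleftrightarrow> (\<forall>a\<in>K. 0 \<le> a \<longrightarrow> sqrt a \<in> K)"

definition real_quadratic_closure :: "real set" where
  "real_quadratic_closure = \<Inter>{K. real_subfield K \<and> sqrt_closed K}"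

text \<open>The intersection is itself a subfield closed under square roots, hence the least one.\<close>

lemma real_subfield_real_quadratic_closure: "real_subfield real_quadratic_closure"
  unfolding real_quadratic_closure_def real_subfield_def by blast

lemma sqrt_closed_real_quadratic_closure: "sqrt_closed real_quadratic_closure"
  unfolding real_quadratic_closure_def sqrt_closed_def by blast

lemma real_quadratic_closure_least:
  "real_subfield K \<Longrightarrow> sqrt_closed K \<Longrightarrow> real_quadratic_closure \<subseteq> K"
  unfolding real_quadratic_closure_def by blast

definition constructible :: "real \<Rightarrow> bool" where
  "constructible r \<longleftrightarrow> 0 \<le> r \<and> r \<in> real_quadratic_closure"

text \<open>A map defined only on \<open>S\<close> is represented by a total function of which only
  the values on \<open>S\<close> are constrained.\<close>

definition preserves_unit_distance_on ::
    "(real ^ 'n) set \<Rightarrow> (real ^ 'n \<Rightarrow> real ^ 'n) \<Rightarrow> bool" where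
  "preserves_unit_distance_on S f \<longleftrightarrow>
     (\<forall>a\<in>S. \<forall>b\<in>S. norm (a - b) = 1 \<longrightarrow> norm (f a - f b) = 1)"

end

theory Submission
  imports Defs
begin

text \<open>
  Call a distance rigid if some finite configuration forces every unit-distance preserving map to keep
  it. The rigid distances, with signs attached, turn out to form a subfield of the reals closed under
  square roots; this subfield contains the real quadratic closure of the rationals, so every
  constructible distance is rigid.

  The dimension \<open>n\<close> enters twice. First, a point at distance \<open>d\<close> from the \<open>n\<close> vertices of a
  facet of edge \<open>d\<close> is one of two mirror images, so regular simplices glued along a facet stay glued or
  collapse, and an extra triangle prevents the collapse (\<open>rigid_height\<close>, \<open>eventually_mirror\<close>). Reflecting
  two vertices of a simplex in their opposite facets shows that rigid distances can be multiplied by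
  \<open>l = 1 + 2 / n\<close>, and gluing twice that they can be multiplied by \<open>1 + l = 2 + 2 / n\<close>. Three collinear
  points at distances \<open>d\<close>, \<open>l d\<close>, \<open>(1 + l) d\<close> are then mapped affinely.

  From this single ratio, plane geometry gives all rational ones. A product of two homotheties is a
  translation, so rhombi with an angle of 60 degrees go to parallelograms (\<open>eventually_rhombus\<close>); two of
  them show that midpoints are respected (\<open>eventually_reflect\<close>), so natural multiples are, and the
  intercept theorem (\<open>homothetic_thales\<close>) allows division. The median of an isosceles triangle turns rigid
  \<open>a\<close> and \<open>b\<close> into \<open>sqrt (a\<^sup>2 - b\<^sup>2)\<close>, and since the squares of rigid distances are closed under differences
  and natural multiples, they are closed under sums.

  So right angles are respected, and this is the second place for the dimension: \<open>n\<close> orthonormal vectors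
  have orthonormal images, which confines the image of \<open>a e\<close>, for a unit vector \<open>e\<close> and rigid \<open>a\<close>, to a
  line. A nearby rational point selects the side (\<open>homothetic_rigid_length\<close>). Rigid lengths can thus be
  marked off on a line, which yields sums and differences; the intercept theorem with a rigid ratio
  yields products and inverses, and the difference of two squares yields square roots.
\<close>

section \<open>Properties forced by finitely many unit distances\<close>

text \<open>
  \<open>eventually Q unit_preserving\<close> says that some finite set \<open>S\<close> forces \<open>Q\<close> on every map preserving unit
  distance on \<open>S\<close>. The finite sets of several such statements can be united, which is what being a
  filter means; in this way the sets never have to be written down.
\<close>
definition unit_preserving :: "(real ^ 'n \<Rightarrow> real ^ 'n) filter" where
  "unit_preserving = (INF S\<in>{S. finite S}. principal {f. preserves_unit_distance_on S f})"

lemma preserves_unit_distance_on_mono: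
  "preserves_unit_distance_on S f \<Longrightarrow> T \<subseteq> S \<Longrightarrow> preserves_unit_distance_on T f"
  unfolding preserves_unit_distance_on_def by blast

lemma eventually_unit_preserving:
  "eventually Q unit_preserving \<longleftrightarrow> 
     (\<exists>S :: (real ^ 'n) set. finite S \<and> (\<forall>f. preserves_unit_distance_on S f \<longrightarrow> Q f))"
proof -
  have "eventually Q (INF S\<in>{S :: (real ^ 'n) set. finite S}. principal {f. preserves_unit_distance_on S f})
    \<longleftrightarrow> (\<exists>S\<in>{S. finite S}. eventually Q (principal {f. preserves_unit_distance_on S f}))"
  proof (rule eventually_INF_base)
    fix A B :: "(real ^ 'n) set"
    assume "A \<in> {S. finite S}" "B \<in> {S. finite S}"
    then show "\<exists>C\<in>{S. finite S}. principal {f. preserves_unit_distance_on C f}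
        \<le> inf (principal {f. preserves_unit_distance_on A f}) (principal {f. preserves_unit_distance_on B f})"
      by (intro bexI[of _ "A \<union> B"])
         (auto intro: preserves_unit_distance_on_mono)
  qed auto
  then show ?thesis
    by (auto simp: unit_preserving_def eventually_principal)
qed

lemma eventually_compose_isometry:
  fixes g :: "real ^ 'n \<Rightarrow> real ^ 'n"
  assumes "eventually Q unit_preserving" and "\<And>a b. norm (g a - g b) = norm (a - b)"
  shows "\<forall>\<^sub>F f in unit_preserving. Q (\<lambda>z. f (g z))"
proof -
  obtain S :: "(real ^ 'n) set" where S: "finite S" "\<And>f. preserves_unit_distance_on S f \<Longrightarrow> Q f"
    using assms(1) by (auto simp: eventually_unit_preserving)
  have "preserves_unit_distance_on S (\<lambda>z. f (g z))" if "preserves_unit_distance_on (g ` S) f" for f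
    using that assms(2) by (auto simp: preserves_unit_distance_on_def)
  then show ?thesis
    unfolding eventually_unit_preserving using S by (intro exI[of _ "g ` S"]) auto
qed

text \<open>
  The last property serves to transport statements about points on a line.
\<close>
lemma isometry_between_pairs:
  fixes x y x' y' :: "real ^ 'n"
  assumes "norm (x - y) = norm (x' - y')"
  obtains g where "\<And>a b. norm (g a - g b) = norm (a - b)" "g x = x'" "g y = y'"
    and "\<And>a b. g (x + a *\<^sub>R b) = x' + a *\<^sub>R (g (x + b) - x')"
proof -
  obtain T where T: "orthogonal_transformation T" "T (y - x) = y' - x'"
    using orthogonal_transformation_exists[of "y - x" "y' - x'"] assms by (auto simp: norm_minus_commute)
  interpret T: linear T using T(1) by (rule orthogonal_transformation_linear)
  define g where "g z = x' + T (z - x)" for z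
  show thesis
  proof
    show "norm (g a - g b) = norm (a - b)" for a b
      using orthogonal_transformation_norm[OF T(1), of "a - b"] 
      by (simp add: g_def T.diff)
  qed (simp_all add: g_def T(2) T.scaleR)
qed

text \<open>
  The first argument carries the dimension, on which the set of rigid distances may a priori depend.
\<close>
definition rigid :: "'n::finite itself \<Rightarrow> real \<Rightarrow> bool" where
  "rigid _ d \<longleftrightarrow> (\<forall>x y :: real ^ 'n. norm (x - y) = d \<longrightarrow>
     (\<forall>\<^sub>F f in unit_preserving. norm (f x - f y) = d))"

lemma rigidD:
  "rigid TYPE('n::finite) d \<Longrightarrow> norm (x - y :: real ^ 'n) = d \<Longrightarrow>
    \<forall>\<^sub>F f in unit_preserving. norm (f x - f y) = d"
  by (simp add: rigid_def)

text \<open>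
  Any two pairs of points at the same distance are related by an isometry, so a property of the image
  distance needs to be forced for one pair only, in whatever position is convenient.
\<close>
lemma eventually_norm_transport:
  fixes x y x' y' :: "real ^ 'n"
  assumes "\<forall>\<^sub>F f in unit_preserving. P (norm (f x - f y))" "norm (x' - y') = norm (x - y)"
  shows "\<forall>\<^sub>F f in unit_preserving. P (norm (f x' - f y'))"
proof -
  obtain g where g: "\<And>a b. norm (g a - g b) = norm (a - b)" "g x = x'" "g y = y'"
    by (rule isometry_between_pairs[OF assms(2)[symmetric]]) blast
  then show ?thesis
    using eventually_compose_isometry[OF assms(1), of g] by simp
qed

lemma rigidI:
  fixes x y :: "real ^ 'n"
  assumes "\<forall>\<^sub>F f in unit_preserving. norm (f x - f y) = d" "norm (x - y) = d"
  shows "rigid TYPE('n) d"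
  unfolding rigid_def using eventually_norm_transport[of "\<lambda>r. r = d" x y] assms by auto

lemma rigid_0: "rigid TYPE('n::finite) 0"
  by (simp add: rigid_def)

lemma rigid_1: "rigid TYPE('n::finite) 1"
  unfolding rigid_def
proof (intro allI impI)
  fix x y :: "real ^ 'n"
  assume "norm (x - y) = 1"
  then show "\<forall>\<^sub>F f in unit_preserving. norm (f x - f y) = 1"
    unfolding eventually_unit_preserving preserves_unit_distance_on_def
    by (intro exI[of _ "{x, y}"]) auto
qed

text \<open>
  The apex is found on a line through the midpoint orthogonal to \<open>x - y\<close>, so the dimension has to
  exceed one.
\<close>
lemma isosceles_apex:
  fixes x y :: "real ^ 'n"
  assumes "CARD('n) > 1" "norm (x - y) \<le> 2 * L"
  obtains m where "norm (m - x) = L" "norm (m - y) = L"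
proof -
  obtain w where w: "w \<noteq> 0" "orthogonal (x - y) w"
    using orthogonal_to_vector_exists[of "x - y"] assms(1) by auto
  define h where "h = (1/2) *\<^sub>R (x - y)"
  define t where "t = sqrt (L\<^sup>2 - (norm h)\<^sup>2) / norm w"
  have h: "norm h \<le> L" "0 \<le> L" using assms(2) norm_ge_zero[of "x-y"] unfolding h_def
    by (simp, linarith)
  have "(t * norm w)\<^sup>2 = L\<^sup>2 - (norm h)\<^sup>2"
    using h w by (simp add: t_def power_mono)
  define k where "k = t *\<^sub>R w"
  have k: "k \<bullet> k = L\<^sup>2 - h \<bullet> h"
    using \<open>(t * norm w)\<^sup>2 = _\<close>
    by (simp add: k_def power_mult_distrib power2_norm_eq_inner power2_eq_square[of t])
  have hk: "h \<bullet> k = 0" using w(2) by (simp add: h_def k_def orthogonal_def)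
  have "(norm (k - h))\<^sup>2 = L\<^sup>2" "(norm (k + h))\<^sup>2 = L\<^sup>2"
    using k hk by (simp_all add: power2_norm_eq_inner inner_diff inner_add inner_commute)
  then have n: "norm (k - h) = L" "norm (k + h) = L"
    using h(2) by (auto simp: power2_eq_iff_nonneg)
  have e: "x - h + k - x = k - h" "x - h + k - y = k + h" 
    by (simp_all add: h_def algebra_simps vec_eq_iff)
  show thesis
    by (rule that[of "x - h + k"]) (simp_all only: e n)
qed

section \<open>Regular simplices and their mirror images\<close>

text \<open>
  The Gram matrix is \<open>\<alpha>\<close> times the all-ones matrix plus \<open>\<beta>\<close> times the identity, so it is positive
  definite; the \<open>n\<close> vectors are therefore independent and span the space. Both families for which the
  dimension matters have this form: the edges of a regular simplex at a vertex, and an orthonormal frame.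
\<close>
lemma orthogonal_gram_imp_zero:
  fixes u :: "'n::finite \<Rightarrow> real ^ 'n"
  assumes gram: "\<And>i j. u i \<bullet> u j = \<alpha> + (if i = j then \<beta> else 0)" and "\<alpha> \<ge> 0" "\<beta> > 0"
    and v: "\<And>j. v \<bullet> u j = 0"
  shows "v = 0"
proof -
  define L :: "real ^ 'n \<Rightarrow> real ^ 'n" where "L c = (\<Sum>j\<in>UNIV. c $ j *\<^sub>R u j)" for c
  have lin: "linear L"
    by (rule linearI) (simp_all add: L_def algebra_simps sum.distrib scaleR_sum_right)
  have "c = 0" if "L c = 0" for c
  proof -
    have "0 = L c \<bullet> L c" using that by simp
    also have "\<dots> = (\<Sum>i\<in>UNIV. \<Sum>j\<in>UNIV. c $ i * c $ j * (\<alpha> + (if i = j then \<beta> else 0)))"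
      unfolding L_def inner_sum_left unfolding inner_sum_right by (simp add: gram mult.assoc mult.left_commute)
    also have "\<dots> = \<alpha> * (\<Sum>i\<in>UNIV. c $ i)\<^sup>2 + \<beta> * (\<Sum>i\<in>UNIV. (c $ i)\<^sup>2)"
    proof -
      have "(\<Sum>j\<in>UNIV. c $ i * c $ j * (\<alpha> + (if i = j then \<beta> else 0)))
          = \<alpha> * c $ i * (\<Sum>j\<in>UNIV. c $ j) + \<beta> * (c $ i)\<^sup>2" for i
      proof -
        have "(\<Sum>j\<in>UNIV. c $ i * c $ j * (\<alpha> + (if i = j then \<beta> else 0)))
            = (\<Sum>j\<in>UNIV. \<alpha> * c $ i * c $ j + (if i = j then \<beta> * (c $ i)\<^sup>2 else 0))"
          by (rule sum.cong) (auto simp: algebra_simps power2_eq_square)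
        then show ?thesis by (simp add: sum.distrib sum_distrib_left)
      qed
      then show ?thesis
        by (simp add: sum.distrib power2_eq_square mult.assoc flip: sum_distrib_left sum_distrib_right)
    qed
    finally have z: "\<alpha> * (\<Sum>i\<in>UNIV. c $ i)\<^sup>2 + \<beta> * (\<Sum>i\<in>UNIV. (c $ i)\<^sup>2) = 0" by simp
    have "\<alpha> * (\<Sum>i\<in>UNIV. c $ i)\<^sup>2 \<ge> 0" "(\<Sum>i\<in>UNIV. (c $ i)\<^sup>2) \<ge> 0"
      using assms(2) by (auto intro: sum_nonneg)
    then have "(\<Sum>i\<in>UNIV. (c $ i)\<^sup>2) = 0"
      using z \<open>\<beta> > 0\<close> by (smt (verit) mult_pos_pos)
    then show ?thesis by (simp add: sum_nonneg_eq_0_iff vec_eq_iff)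
  qed
  then have "inj L" using linear_injective_0[OF lin] by blast
  then obtain c where "v = L c"
    using linear_injective_imp_surjective[OF lin] by (metis surjD)
  then have "v \<bullet> v = (\<Sum>j\<in>UNIV. c $ j * (v \<bullet> u j))"
    by (simp add: L_def inner_sum_right)
  then show ?thesis by (simp add: v)
qed

text \<open>
  A simplex with \<open>n + 1\<close> vertices is presented as one apex \<open>X\<close> and a facet \<open>Z\<close> indexed by the \<open>n\<close>
  coordinates.
\<close>
definition regular_simplex :: "real \<Rightarrow> real ^ 'n \<Rightarrow> ('n \<Rightarrow> real ^ 'n) \<Rightarrow> bool" where
  "regular_simplex d X Z \<longleftrightarrow> (\<forall>i. norm (X - Z i) = d) \<and> (\<forall>i j. i \<noteq> j \<longrightarrow> norm (Z i - Z j) = d)"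

text \<open>
  For a regular simplex this is the reflection of the apex in the facet: the foot of the altitude from
  \<open>X\<close> is the centroid of the \<open>Z i\<close>.
\<close>
definition mirror :: "real ^ 'n \<Rightarrow> ('n \<Rightarrow> real ^ 'n) \<Rightarrow> real ^ 'n" where
  "mirror X Z = (2 / CARD('n)) *\<^sub>R (\<Sum>i\<in>UNIV. Z i) - X"

lemma simplex_exists:
  assumes "d \<ge> 0"
  obtains X and Z :: "'n::finite \<Rightarrow> real ^ 'n" where "regular_simplex d X Z"
proof -
  define n where "n = real CARD('n)"
  have n: "n > 0" by (simp add: n_def)
  \<comment> \<open>the facet has its vertices on the coordinate axes; the apex \<open>s (t, \<dots>, t)\<close> needs \<open>n t\<^sup>2 - 2 t - 1 = 0\<close>\<close>
  define t where "t = (1 + sqrt (1 + n)) / n"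
  define s where "s = d / sqrt 2"
  have q: "n * t\<^sup>2 - 2 * t - 1 = 0"
    using n by (simp add: t_def field_simps power2_eq_square)
  define X :: "real ^ 'n" where "X = (\<chi> i. s * t)"
  define Z :: "'n \<Rightarrow> real ^ 'n" where "Z i = axis i s" for i
  have s: "2 * s\<^sup>2 = d\<^sup>2" by (simp add: s_def power_divide)
  have XX: "X \<bullet> X = n * (s * t)\<^sup>2" by (simp add: X_def inner_vec_def n_def power2_eq_square)
  have XZ: "X \<bullet> Z i = s * (s * t)" for i by (simp add: X_def Z_def inner_axis)
  have ZZ: "Z i \<bullet> Z j = (if i = j then s\<^sup>2 else 0)" for i j
    by (simp add: Z_def inner_axis_axis power2_eq_square)
  have "(norm (X - Z i))\<^sup>2 = d\<^sup>2" for i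
  proof -
    have "(norm (X - Z i))\<^sup>2 = n * (s * t)\<^sup>2 - 2 * (s * (s * t)) + s\<^sup>2"
      by (simp add: power2_norm_eq_inner inner_simps XX XZ ZZ inner_commute[of "Z i"])
    also have "\<dots> = s\<^sup>2 * (n * t\<^sup>2 - 2 * t - 1) + 2 * s\<^sup>2" by (simp add: algebra_simps power2_eq_square)
    finally show ?thesis by (simp add: q s)
  qed
  moreover have "(norm (Z i - Z j))\<^sup>2 = d\<^sup>2" if "i \<noteq> j" for i j
    using that s by (simp add: power2_norm_eq_inner inner_simps ZZ)
  ultimately have "regular_simplex d X Z"
    unfolding regular_simplex_def using assms by (metis norm_ge_zero power2_eq_iff_nonneg)
  then show thesis by (rule that)
qed

lemma simplex_gram:
  assumes "regular_simplex d X Z"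
  shows "(Z i - X) \<bullet> (Z j - X) = d\<^sup>2 / 2 + (if i = j then d\<^sup>2 / 2 else 0)"
proof -
  have n: "norm (Z i - X) = d" "norm (Z j - X) = d" "i \<noteq> j \<Longrightarrow> norm (Z i - Z j) = d"
    using assms by (auto simp: regular_simplex_def norm_minus_commute)
  have "(norm (Z i - Z j))\<^sup>2 = (norm (Z i - X))\<^sup>2 + (norm (Z j - X))\<^sup>2 - 2 * ((Z i - X) \<bullet> (Z j - X))"
    by (simp add: power2_norm_eq_inner inner_simps inner_commute)
  then show ?thesis using n by (cases "i = j") (auto simp: power2_norm_eq_inner)
qed

lemma simplex_sum:
  fixes Z :: "'n::finite \<Rightarrow> real ^ 'n" and d :: real
  assumes "regular_simplex d X Z"
  defines "U \<equiv> \<Sum>i\<in>UNIV. Z i - X"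
  shows "U \<bullet> (Z j - X) = d\<^sup>2 * (real CARD('n) + 1) / 2" "U \<bullet> U = CARD('n) * (d\<^sup>2 * (real CARD('n) + 1) / 2)"
    "mirror X Z - X = (2 / CARD('n)) *\<^sub>R U"
proof -
  show 1: "U \<bullet> (Z j - X) = d\<^sup>2 * (real CARD('n) + 1) / 2" for j
  proof -
    have "U \<bullet> (Z j - X) = (\<Sum>i\<in>UNIV. d\<^sup>2 / 2 + (if i = j then d\<^sup>2 / 2 else 0))"
      by (simp add: U_def inner_sum_left simplex_gram[OF assms(1)])
    also have "\<dots> = d\<^sup>2 * (real CARD('n) + 1) / 2"
      by (subst sum.distrib) (simp add: algebra_simps add_divide_distrib)
    finally show ?thesis .
  qed
  have "U \<bullet> U = (\<Sum>j\<in>UNIV. U \<bullet> (Z j - X))"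
    by (subst (2) U_def) (rule inner_sum_right)
  then show "U \<bullet> U = CARD('n) * (d\<^sup>2 * (real CARD('n) + 1) / 2)" unfolding 1 by simp
  show "mirror X Z - X = (2 / CARD('n)) *\<^sub>R U"
    by (simp add: U_def mirror_def vec_eq_iff sum_subtractf sum_constant_scaleR field_simps
        del: sum_constant)
qed

lemma norm_mirror:
  fixes Z :: "'n::finite \<Rightarrow> real ^ 'n" and d :: real
  assumes "regular_simplex d X Z" "d \<ge> 0"
  shows "norm (mirror X Z - X) = sqrt (2 + 2 / CARD('n)) * d"
proof -
  define n where "n = real CARD('n)"
  have n: "n > 0" by (simp add: n_def)
  have "(norm (mirror X Z - X))\<^sup>2 = (2 / n)\<^sup>2 * (n * (d\<^sup>2 * (n + 1) / 2))"
    unfolding simplex_sum(3)[OF assms(1)] power2_norm_eq_inner n_def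
    by (simp add: simplex_sum(2)[OF assms(1)] power2_eq_square)
  also have "\<dots> = (sqrt (2 + 2 / n) * d)\<^sup>2" using n by (simp add: power_mult_distrib field_simps power2_eq_square)
  finally show ?thesis using assms(2) n by (simp add: n_def power2_eq_iff_nonneg)
qed

lemma norm_mirror_vertex:
  fixes Z :: "'n::finite \<Rightarrow> real ^ 'n" and d :: real
  assumes "regular_simplex d X Z" "d \<ge> 0"
  shows "norm (mirror X Z - Z j) = d"
proof -
  define n where "n = real CARD('n)"
  have n: "n > 0" by (simp add: n_def)
  define U where "U = (\<Sum>i\<in>UNIV. Z i - X)"
  have "mirror X Z - Z j = (mirror X Z - X) - (Z j - X)" by simp
  also have "\<dots> = (2 / n) *\<^sub>R U - (Z j - X)"
    using simplex_sum(3)[OF assms(1)] by (simp add: U_def n_def)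
  finally have e: "mirror X Z - Z j = (2 / n) *\<^sub>R U - (Z j - X)" .
  have "(norm (s *\<^sub>R U - q))\<^sup>2 = s\<^sup>2 * (U \<bullet> U) - 2 * (s * (U \<bullet> q)) + q \<bullet> q" for s q
    unfolding power2_norm_eq_inner by (simp add: inner_diff inner_commute power2_eq_square)
  from this[of "2 / n" "Z j - X"] have "(norm (mirror X Z - Z j))\<^sup>2
      = (2 / n)\<^sup>2 * (U \<bullet> U) - 2 * ((2/n) * (U \<bullet> (Z j - X))) + (Z j - X) \<bullet> (Z j - X)"
    by (simp only: e)
  also have "\<dots> = (2 / n)\<^sup>2 * (n * (d\<^sup>2 * (n + 1) / 2)) - 2 * ((2/n) * (d\<^sup>2 * (n + 1) / 2)) + d\<^sup>2"
    unfolding U_def n_def simplex_sum(1,2)[OF assms(1)] using simplex_gram[OF assms(1), of j j] by simp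
  also have "\<dots> = d\<^sup>2" using n by (simp add: field_simps power2_eq_square)
  finally show ?thesis using assms(2) by (simp add: power2_eq_iff_nonneg)
qed

text \<open>
  Equating the distances of \<open>X\<close> and \<open>Y\<close> to \<open>Z j\<close> shows that \<open>w = Y - X\<close> has the same inner product
  with every edge \<open>Z j - X\<close>. So does a multiple of the edge sum \<open>U\<close>, and the edges span, hence \<open>w\<close> is
  itself a multiple of \<open>U\<close>. Its length then leaves exactly one non-zero choice.
\<close>
lemma simplex_apex_cases:
  fixes Z :: "'n::finite \<Rightarrow> real ^ 'n"
  assumes X: "regular_simplex d X Z" and Y: "\<And>i. norm (Y - Z i) = d" and "d > 0"
  shows "Y = X \<or> Y = mirror X Z"
proof (cases "Y = X")
  case False
  define n where "n = real CARD('n)"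
  define w where "w = Y - X"
  define U where "U = (\<Sum>i\<in>UNIV. Z i - X)"
  have n: "n > 0" by (simp add: n_def)
  have Uj: "U \<bullet> (Z j - X) = d\<^sup>2 * (n + 1) / 2" and UU: "U \<bullet> U = n * (d\<^sup>2 * (n + 1) / 2)" for j
    using simplex_sum[OF X] by (simp_all add: U_def n_def)
  have w: "w \<bullet> (Z j - X) = (w \<bullet> w) / 2" for j
  proof -
    have "(norm (Y - Z j))\<^sup>2 = (norm (X - Z j))\<^sup>2" using X Y by (simp add: regular_simplex_def)
    then show ?thesis by (simp add: w_def power2_norm_eq_inner inner_simps inner_commute)
  qed
  define \<alpha> where "\<alpha> = (w \<bullet> w) / (d\<^sup>2 * (n + 1))"
  have \<alpha>: "\<alpha> * (d\<^sup>2 * (n + 1)) = w \<bullet> w" using n \<open>d > 0\<close> by (simp add: \<alpha>_def)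
  have "w - \<alpha> *\<^sub>R U = 0"
  proof (rule orthogonal_gram_imp_zero[OF simplex_gram[OF X]])
    show "(w - \<alpha> *\<^sub>R U) \<bullet> (Z j - X) = 0" for j
      using \<alpha> by (simp add: inner_diff_left Uj w)
  qed (use \<open>d > 0\<close> in auto)
  then have wU: "w = \<alpha> *\<^sub>R U" by simp
  have "w \<bullet> w \<noteq> 0" using False by (simp add: w_def)
  moreover have "w \<bullet> w = \<alpha>\<^sup>2 * (n * (d\<^sup>2 * (n + 1) / 2))"
    by (subst (1 2) wU) (simp add: UU power2_eq_square)
  then have "2 * (w \<bullet> w) = \<alpha>\<^sup>2 * (n * (d\<^sup>2 * (n + 1)))" by simp
  then have "(w \<bullet> w) * (\<alpha> * n - 2) = 0" using \<alpha> by algebra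
  ultimately have "\<alpha> * n - 2 = 0" by simp
  then have "\<alpha> * n = 2" by simp
  then have "\<alpha> = 2 / n" using n by (simp add: field_simps)
  then have "Y - X = mirror X Z - X"
    using wU simplex_sum(3)[OF X] by (simp add: w_def n_def U_def)
  then show ?thesis by simp
qed simp

section \<open>Unit-distance preserving maps respect mirror images\<close>

lemma eventually_regular_simplex:
  fixes Z :: "'n::finite \<Rightarrow> real ^ 'n" and d :: real
  assumes "regular_simplex d X Z" "rigid TYPE('n) d"
  shows "\<forall>\<^sub>F f in unit_preserving. regular_simplex d (f X) (\<lambda>i. f (Z i))"
  unfolding regular_simplex_def using assms
  by (intro eventually_conj eventually_all_finite)
     (auto simp: regular_simplex_def intro: rigidD)

text \<open>
  The images of the simplex form a regular simplex again, and the image of the mirrored apex is as far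
  from the image facet as the image of the apex; nothing yet prevents the two apexes from being
  identified.
\<close>
lemma eventually_mirror_or_collapse:
  fixes Z :: "'n::finite \<Rightarrow> real ^ 'n" and d :: real
  assumes "regular_simplex d X Z" "rigid TYPE('n) d" "d > 0"
  shows "\<forall>\<^sub>F f in unit_preserving.
    f (mirror X Z) = f X \<or> f (mirror X Z) = mirror (f X) (\<lambda>i. f (Z i))"
proof -
  have "\<forall>\<^sub>F f in unit_preserving. \<forall>i. norm (f (mirror X Z) - f (Z i)) = d"
    using assms by (intro eventually_all_finite rigidD) (auto intro: norm_mirror_vertex)
  with eventually_regular_simplex[OF assms(1,2)] show ?thesis
  proof eventually_elim
    case (elim f)
    then show ?case using simplex_apex_cases[OF elim(1)] assms(3) by blast
  qed
qed

text \<open>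
  The ratio is the distance between the two apexes over a common facet. Collapse of such a pair is
  excluded by an isosceles triangle with legs \<open>h\<close>, the apex distance, and base \<open>d\<close>: if the images of the
  ends of one leg coincided, the image of the other leg would have length \<open>d\<close>, which is neither \<open>0\<close> nor
  \<open>h\<close>.
\<close>
lemma rigid_height:
  fixes d :: real
  assumes n: "CARD('n::finite) > 1" and d: "rigid TYPE('n) d" "d > 0"
  shows "rigid TYPE('n) (sqrt (2 + 2 / CARD('n)) * d)"
proof -
  define h where "h = sqrt (2 + 2 / CARD('n)) * d"
  have "1 < sqrt (2 + 2 / CARD('n))" by (simp add: add_pos_nonneg)
  then have h: "h > d" using d(2) by (simp add: h_def)
  obtain X and Z :: "'n \<Rightarrow> real ^ 'n" where XZ: "regular_simplex d X Z"
    using simplex_exists d(2) by (metis less_imp_le)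
  have nm: "norm (mirror X Z - X) = h"
    using norm_mirror[OF XZ] d(2) by (simp add: h_def)
  have "\<forall>\<^sub>F f in unit_preserving. norm (f (mirror X Z) - f X) \<in> {0, h}"
    using eventually_mirror_or_collapse[OF XZ d] eventually_regular_simplex[OF XZ d(1)]
  proof eventually_elim
    case (elim f)
    then show ?case using norm_mirror[OF elim(2)] d(2) by (auto simp: h_def)
  qed
  then have *: "\<forall>\<^sub>F f in unit_preserving. norm (f x - f y) \<in> {0, h}"
    if "norm (x - y) = h" for x y :: "real ^ 'n"
    using eventually_norm_transport[of "\<lambda>r. r \<in> {0, h}" "mirror X Z" X x y] nm that by simp
  obtain p :: "real ^ 'n" where p: "norm p = d"
    using vector_choose_size[of d] d(2) by auto
  obtain m where m: "norm (m - 0) = h" "norm (m - p) = h"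
    using isosceles_apex[of 0 p h] n h p d(2) by auto
  have p': "norm (p - 0) = d" using p by simp
  have "\<forall>\<^sub>F f in unit_preserving. norm (f m - f 0) = h"
    using *[OF m(1)] *[OF m(2)] rigidD[OF d(1) p']
  proof eventually_elim
    case (elim f)
    then show ?case using h d(2) p
      by (cases "f m = f 0") (auto simp: norm_minus_commute)
  qed
  then show ?thesis using rigidI m(1) unfolding h_def by blast
qed

lemma eventually_mirror:
  fixes Z :: "'n::finite \<Rightarrow> real ^ 'n" and d :: real
  assumes n: "CARD('n) > 1" and "regular_simplex d X Z" "rigid TYPE('n) d" "d > 0"
  shows "\<forall>\<^sub>F f in unit_preserving. f (mirror X Z) = mirror (f X) (\<lambda>i. f (Z i))"
proof -
  define h where "h = sqrt (2 + 2 / CARD('n)) * d"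
  have h: "h > 0" using assms by (simp add: h_def add_pos_nonneg)
  have "\<forall>\<^sub>F f in unit_preserving. norm (f (mirror X Z) - f X) = h"
    using rigidD[OF rigid_height[OF n assms(3,4)]] norm_mirror[OF assms(2)] assms(4) by (simp add: h_def)
  with eventually_mirror_or_collapse[OF assms(2-4)] show ?thesis
    by eventually_elim (use h in auto)
qed

lemma regular_simplex_exchange:
  "regular_simplex d X Z \<Longrightarrow> regular_simplex d (Z i) (Z(i := X))"
  by (auto simp: regular_simplex_def norm_minus_commute)

text \<open>
  Reflecting the vertices of a simplex, each in its opposite facet, produces a copy of the simplex
  scaled by \<open>- (1 + 2 / n)\<close>.
\<close>
lemma mirror_exchange_diff:
  fixes Z :: "'n::finite \<Rightarrow> real ^ 'n"
  shows "mirror (Z i) (Z(i := X)) - mirror (Z j) (Z(j := X)) = - (1 + 2 / CARD('n)) *\<^sub>R (Z i - Z j)"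
proof -
  have "(\<Sum>k\<in>UNIV. (Z(i := X)) k) = (\<Sum>k\<in>UNIV. Z k) - Z i + X" for i
    by (simp add: sum.remove[of UNIV i] algebra_simps cong: sum.cong_simp)
  then show ?thesis unfolding mirror_def
    by (simp del: fun_upd_apply) (simp add: vec_eq_iff field_simps)
qed

lemma rigid_mirror_ratio:
  fixes d :: real
  assumes n: "CARD('n::finite) > 1" and d: "rigid TYPE('n) d" "d > 0"
  shows "rigid TYPE('n) ((1 + 2 / CARD('n)) * d)"
proof -
  obtain X and Z :: "'n \<Rightarrow> real ^ 'n" where XZ: "regular_simplex d X Z"
    using simplex_exists d(2) by (metis less_imp_le)
  obtain i j :: 'n where ij: "i \<noteq> j"
    using n by (metis (full_types) One_nat_def UNIV_I card.empty card.infinite card_1_singleton_iff 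
        card_le_Suc0_iff_eq finite leD)
  define A where "A i = mirror (Z i) (Z(i := X))" for i
  have A: "norm (A i - A j) = (1 + 2 / CARD('n)) * d"
    using XZ ij by (simp add: A_def mirror_exchange_diff regular_simplex_def del: minus_add_distrib)
  have m: "\<forall>\<^sub>F f in unit_preserving. f (A i) = mirror (f (Z i)) ((\<lambda>k. f (Z k))(i := f X))" for i
    using eventually_mirror[OF n regular_simplex_exchange[OF XZ] d, of i]
    by (simp add: A_def fun_upd_def if_distrib cong: if_cong)
  have "\<forall>\<^sub>F f in unit_preserving. norm (f (A i) - f (A j)) = (1 + 2 / CARD('n)) * d"
    using m[of i] m[of j] eventually_regular_simplex[OF XZ d(1)]
  proof eventually_elim
    case (elim f)
    show ?case unfolding elim(1,2) mirror_exchange_diff[of "\<lambda>k. f (Z k)"]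
      using elim(3) ij by (simp add: regular_simplex_def del: minus_add_distrib)
  qed
  then show ?thesis using A by (rule rigidI)
qed

section \<open>Homotheties, doubling, and the intercept theorem\<close>

text \<open>
  The homothety of ratio \<open>c\<close> with centre \<open>p\<close> is respected on points at distance \<open>d\<close> from \<open>p\<close>.
\<close>
definition homothetic :: "'n::finite itself \<Rightarrow> real \<Rightarrow> real \<Rightarrow> bool" where
  "homothetic _ d c \<longleftrightarrow> (\<forall>p u :: real ^ 'n. norm u = d \<longrightarrow>
     (\<forall>\<^sub>F f in unit_preserving. f (p + c *\<^sub>R u) = f p + c *\<^sub>R (f (p + u) - f p)))"

lemma homotheticD:
  "homothetic TYPE('n::finite) d c \<Longrightarrow> norm (u :: real ^ 'n) = d \<Longrightarrow>
     \<forall>\<^sub>F f in unit_preserving. f (p + c *\<^sub>R u) = f p + c *\<^sub>R (f (p + u) - f p)"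
  by (simp add: homothetic_def)

text \<open>
  Three collinear points at distances \<open>d\<close>, \<open>l d\<close> and \<open>(1 + l) d\<close> attain equality in the triangle
  inequality. If all three distances are kept, so is this equality, and strict convexity of the norm
  puts the images on a line in the same proportion.
\<close>
lemma homothetic_of_rigid:
  fixes d l :: real
  assumes d: "rigid TYPE('n::finite) d" "rigid TYPE('n) (l * d)" "rigid TYPE('n) ((1 + l) * d)"
    and l: "l \<ge> 0"
  shows "homothetic TYPE('n) d (1 + l)"
  unfolding homothetic_def
proof (intro allI impI)
  fix p u :: "real ^ 'n"
  assume u: "norm u = d"
  define q where "q = p + (1 + l) *\<^sub>R u"
  have e: "q - (p + u) = l *\<^sub>R u" "q - p = (1 + l) *\<^sub>R u" by (simp_all add: q_def algebra_simps)
  have "norm (p + u - p) = d" "norm (q - (p + u)) = l * d" "norm (q - p) = (1 + l) * d"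
    unfolding e using u l by (simp_all del: scaleR_left_distrib)
  note this[THEN rigidD[rotated]]
  note d(1)[THEN this(1)] d(2)[THEN this(2)] d(3)[THEN this(3)]
  then have "\<forall>\<^sub>F f in unit_preserving. f q = f p + (1 + l) *\<^sub>R (f (p + u) - f p)"
  proof eventually_elim
    case (elim f)
    define a b where "a = f (p + u) - f p" and "b = f q - f (p + u)"
    have n: "norm a = d" "norm b = l * d" "norm (a + b) = (1 + l) * d"
      using elim by (simp_all add: a_def b_def)
    then have "norm a *\<^sub>R b = norm b *\<^sub>R a"
      by (subst norm_triangle_eq[symmetric]) (simp add: algebra_simps)
    then have "d *\<^sub>R b = d *\<^sub>R (l *\<^sub>R a)" unfolding n by (simp add: mult.commute)
    moreover have "a = 0" "b = 0" if "d = 0" using n that by simp_all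
    ultimately have "b = l *\<^sub>R a" by (metis scaleR_cancel_left scaleR_zero_right)
    then show ?case by (simp add: a_def b_def algebra_simps)
  qed
  then show "\<forall>\<^sub>F f in unit_preserving. f (p + (1 + l) *\<^sub>R u) = f p + (1 + l) *\<^sub>R (f (p + u) - f p)"
    by (simp add: q_def)
qed

text \<open>
  A rhombus made of two equilateral triangles is mapped to a parallelogram. The point is that a
  translation is a product of two homotheties of reciprocal ratios: the homothety of ratio \<open>- l\<close> about
  \<open>p\<close> and the one about \<open>q = p + l e\<close> send \<open>p + a\<close> and \<open>z = p + a + (1 + l) e\<close>, respectively, to the
  same point \<open>y\<close>, which expresses \<open>z - (p + a)\<close> by \<open>q - p\<close>. Along the lines in direction \<open>e\<close> both
  vectors are known multiples of the images of \<open>e\<close> at \<open>p + a\<close> and at \<open>p - e\<close>. The triangle conditions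
  ensure that each homothety is applied to a vector of length \<open>d\<close>.
\<close>
lemma eventually_rhombus:
  fixes p a e :: "real ^ 'n"
  assumes h: "homothetic TYPE('n) d (1 + l)" and "l > 0"
    and n: "norm a = d" "norm e = d" "norm (a + e) = d"
  shows "\<forall>\<^sub>F f in unit_preserving. f (p + a + e) - f (p + a) = f p - f (p - e)"
proof -
  define y q z where "y = p - l *\<^sub>R a" and "q = p + l *\<^sub>R e" and "z = p + a + (1 + l) *\<^sub>R e"
  have y1: "p + a + (1 + l) *\<^sub>R (- a) = y" and y2: "z + (1 + l) *\<^sub>R (- (a + e)) = y"
    and q1: "z + - (a + e) = q" and q2: "p - e + (1 + l) *\<^sub>R e = q"
    by (simp_all add: y_def q_def z_def algebra_simps)
  have "norm (- a) = d" "norm (- (a + e)) = d" using n(1,3) by (simp_all only: norm_minus_cancel)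
  note y = homotheticD[OF h this(1), of "p + a", unfolded y1] homotheticD[OF h this(2), of z, unfolded y2 q1]
  from y homotheticD[OF h n(2), of "p - e", unfolded q2] 
    homotheticD[OF h n(2), of "p + a", folded z_def]
  show ?thesis
  proof eventually_elim
    case (elim f)
    define A B C D where "A = f p" "B = f (p - e)" "C = f (p + a)" "D = f (p + a + e)"
    have "(l * (1 + l)) *\<^sub>R (D - C) = (l * (1 + l)) *\<^sub>R (A - B)"
    proof -
      have 1: "f y = C + (1 + l) *\<^sub>R (A - C)" "f y = f z + (1 + l) *\<^sub>R (f q - f z)"
        "f q = B + (1 + l) *\<^sub>R (A - B)" "f z = C + (1 + l) *\<^sub>R (D - C)"
        using elim by (simp_all add: A_B_C_D_def)
      have "(l * (1 + l)) * (D $ i - C $ i) = (l * (1 + l)) * (A $ i - B $ i)" for i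
      proof -
        have "f y $ i = C $ i + (1 + l) * (A $ i - C $ i)" "f y $ i = f z $ i + (1 + l) * (f q $ i - f z $ i)"
        "f q $ i = B $ i + (1 + l) * (A $ i - B $ i)" "f z $ i = C $ i + (1 + l) * (D $ i - C $ i)"
          using arg_cong[OF 1(1), of "\<lambda>v. v $ i"] arg_cong[OF 1(2), of "\<lambda>v. v $ i"]
          arg_cong[OF 1(3), of "\<lambda>v. v $ i"] arg_cong[OF 1(4), of "\<lambda>v. v $ i"] by simp_all
        then show ?thesis by algebra
      qed
      then show ?thesis by (simp add: vec_eq_iff)
    qed
    then have "D - C = A - B" using \<open>l > 0\<close> by auto
    then show ?case by (simp add: A_B_C_D_def)
  qed
qed

text \<open>
  Two adjacent rhombi share the side from \<open>p + a\<close> to \<open>p + a + e\<close>, and their opposite sides are the two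
  halves of the segment from \<open>p - e\<close> to \<open>p + e\<close>. The homothety they require has ratio \<open>1 + l\<close> for
  \<open>l = 1 + 2 / n\<close>; the distance \<open>(1 + l) d\<close> is rigid because \<open>1 + l\<close> is the square of the ratio of apex
  distance to edge.
\<close>
lemma eventually_reflect:
  fixes p e :: "real ^ 'n"
  assumes n: "CARD('n) > 1" and d: "rigid TYPE('n) d" "norm e = d"
  shows "\<forall>\<^sub>F f in unit_preserving. f (p + e) = 2 *\<^sub>R f p - f (p - e)"
proof (cases "d = 0")
  case True
  then show ?thesis using d(2) by (simp add: scaleR_2)
next
  case False
  then have "d > 0" using d(2) by (metis norm_ge_zero less_eq_real_def)
  define l where "l = 1 + 2 / real CARD('n)"
  have l: "l > 0" by (simp add: l_def add_pos_nonneg)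
  have "rigid TYPE('n) (sqrt (2 + 2 / CARD('n)) * (sqrt (2 + 2 / CARD('n)) * d))"
    using \<open>d > 0\<close> by (intro rigid_height n d mult_pos_pos) (simp_all add: add_pos_nonneg)
  also have "sqrt (2 + 2 / CARD('n)) * (sqrt (2 + 2 / CARD('n)) * d) = (1 + l) * d"
    by (simp add: l_def flip: mult.assoc)
  finally have h: "homothetic TYPE('n) d (1 + l)"
    using rigid_mirror_ratio[OF n d(1)] \<open>d > 0\<close> l d(1) 
    by (intro homothetic_of_rigid) (auto simp: l_def)
  have "norm (0 - (- e)) \<le> 2 * d" using d(2) \<open>d > 0\<close> by simp
  then obtain a where a: "norm (a - 0) = d" "norm (a - (- e)) = d"
    using isosceles_apex[OF n] by blast
  have "\<forall>\<^sub>F f in unit_preserving. f (p + a + e) - f (p + a) = f p - f (p - e)"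
    using a d(2) by (intro eventually_rhombus[OF h l]) auto
  moreover have "\<forall>\<^sub>F f in unit_preserving.
      f (p + (a + e) + (- e)) - f (p + (a + e)) = f p - f (p - (- e))"
    using a d(2) by (intro eventually_rhombus[OF h l]) auto
  ultimately show ?thesis
  proof eventually_elim
    case (elim f)
    then have "f p - f (p + e) = - (f p - f (p - e))"
      by (simp add: add.assoc flip: elim(1))
    then show ?case by (simp add: scaleR_2 algebra_simps)
  qed
qed

lemma homothetic_of_nat:
  assumes n: "CARD('n::finite) > 1" and d: "rigid TYPE('n) d"
  shows "homothetic TYPE('n) d (real k)"
  unfolding homothetic_def
proof (intro allI impI)
  fix p u :: "real ^ 'n"
  assume u: "norm u = d"
  show "\<forall>\<^sub>F f in unit_preserving. f (p + real k *\<^sub>R u) = f p + real k *\<^sub>R (f (p + u) - f p)"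
  proof (induction k rule: induct_nat_012)
    case (ge2 k)
    have e: "p + real (Suc k) *\<^sub>R u + u = p + real (Suc (Suc k)) *\<^sub>R u"
      "p + real (Suc k) *\<^sub>R u - u = p + real k *\<^sub>R u" by (simp_all add: vec_eq_iff algebra_simps)
    have "\<forall>\<^sub>F f in unit_preserving. f (p + real (Suc k) *\<^sub>R u + u)
        = 2 *\<^sub>R f (p + real (Suc k) *\<^sub>R u) - f (p + real (Suc k) *\<^sub>R u - u)"
      by (rule eventually_reflect[OF n d u])
    then have "\<forall>\<^sub>F f in unit_preserving. f (p + real (Suc (Suc k)) *\<^sub>R u)
        = 2 *\<^sub>R f (p + real (Suc k) *\<^sub>R u) - f (p + real k *\<^sub>R u)"
      by (simp only: e)
    with ge2 show ?case
    proof eventually_elim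
      case (elim f)
      show ?case unfolding elim(1,2,3) by (simp add: vec_eq_iff algebra_simps)
    qed
  qed auto
qed

text \<open>
  Place the segment of length \<open>b\<close> as the base of an isosceles triangle with legs \<open>L\<close> and scale it about
  the apex: the scaled base is mapped to \<open>c\<close> times the image of the base.
\<close>
lemma homothetic_thales:
  assumes n: "CARD('n::finite) > 1" and h: "homothetic TYPE('n) L c" and "c > 0" "0 \<le> b" "b \<le> 2 * L"
  shows "rigid TYPE('n) (c * b) \<longleftrightarrow> rigid TYPE('n) b"
proof -
  obtain x :: "real ^ 'n" where x: "norm x = b"
    using vector_choose_size[of b] assms(4) by auto
  obtain m where m: "norm (m - x) = L" "norm (m - 0) = L"
    using isosceles_apex[of x 0 L] n x assms(5) by auto
  define X Y where "X = m + c *\<^sub>R (x - m)" and "Y = m + c *\<^sub>R (0 - m)"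
  have XY: "X - Y = c *\<^sub>R (x - 0)" by (simp add: X_def Y_def algebra_simps)
  have "norm (x - m) = L" "norm (0 - m) = L" using m by (simp_all add: norm_minus_commute)
  note homotheticD[OF h this(1), of m, folded X_def] homotheticD[OF h this(2), of m, folded Y_def]
  then have *: "\<forall>\<^sub>F f in unit_preserving. norm (f X - f Y) = c * norm (f x - f 0)"
  proof eventually_elim
    case (elim f)
    have "f X - f Y = c *\<^sub>R (f x - f 0)" unfolding elim by (simp add: scaleR_diff_right)
    then show ?case using \<open>c > 0\<close> by simp
  qed
  have nXY: "norm (X - Y) = c * b" unfolding XY using x \<open>c > 0\<close> by simp
  show ?thesis
  proof
    assume "rigid TYPE('n) (c * b)"
    from rigidD[OF this nXY] * have "\<forall>\<^sub>F f in unit_preserving. norm (f x - f 0) = b"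
      by eventually_elim (use \<open>c > 0\<close> in auto)
    then show "rigid TYPE('n) b" by (rule rigidI) (simp add: x)
  next
    assume "rigid TYPE('n) b"
    then have "\<forall>\<^sub>F f in unit_preserving. norm (f x - f 0) = b"
      by (rule rigidD) (simp add: x)
    with * have "\<forall>\<^sub>F f in unit_preserving. norm (f X - f Y) = c * b"
      by eventually_elim auto
    then show "rigid TYPE('n) (c * b)" using nXY by (rule rigidI)
  qed
qed

lemma rigid_of_homothetic:
  assumes "homothetic TYPE('n::finite) d c" "rigid TYPE('n) d" "d \<ge> 0" "c \<ge> 0"
  shows "rigid TYPE('n) (c * d)"
proof -
  obtain u :: "real ^ 'n" where u: "norm u = d"
    using vector_choose_size[of d] assms(3) by auto
  then have u': "norm (0 + u - 0) = d" by simp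
  from homotheticD[OF assms(1) u, of 0] rigidD[OF assms(2) u']
  have "\<forall>\<^sub>F f in unit_preserving. norm (f (0 + c *\<^sub>R u) - f 0) = c * d"
    by eventually_elim (use assms(4) in simp)
  then show ?thesis by (rule rigidI) (use u assms(4) in simp)
qed

lemma rigid_mult_nat:
  assumes "CARD('n::finite) > 1" "rigid TYPE('n) d" "d \<ge> 0"
  shows "rigid TYPE('n) (real k * d)"
  using rigid_of_homothetic[OF homothetic_of_nat[OF assms(1,2)] assms(2,3)] by simp

lemma rigid_div_nat:
  assumes n: "CARD('n::finite) > 1" and d: "rigid TYPE('n) d" "d \<ge> 0"
  shows "rigid TYPE('n) (d / real k)"
proof (cases "k = 0")
  case False
  have "d / real k \<le> d / 1" using False d(2) by (intro divide_left_mono) auto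
  then have "d / real k \<le> 2 * d" using d(2) by simp
  then show ?thesis
    using homothetic_thales[OF n homothetic_of_nat[OF n d(1)], of k "d / real k"] False d by simp
qed (simp add: rigid_0)

lemma homothetic_rational:
  assumes n: "CARD('n::finite) > 1" and d: "rigid TYPE('n) d" and k: "k > 0"
  shows "homothetic TYPE('n) d (real j / real k)"
  unfolding homothetic_def
proof (intro allI impI)
  fix p u :: "real ^ 'n"
  assume u: "norm u = d"
  define v where "v = (1 / real k) *\<^sub>R u"
  have v: "norm v = d / real k" using u by (simp add: v_def)
  have "d \<ge> 0" using u by auto
  note * = homotheticD[OF homothetic_of_nat[OF n rigid_div_nat[OF n d \<open>d \<ge> 0\<close>]] v, of p]
  from *[of k] *[of j]
  show "\<forall>\<^sub>F f in unit_preserving. f (p + (real j / real k) *\<^sub>R u) = f p + (real j / real k) *\<^sub>R (f (p + u) - f p)"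
  proof eventually_elim
    case (elim f)
    have "real k *\<^sub>R v = u" "real j *\<^sub>R v = (real j / real k) *\<^sub>R u" using k by (simp_all add: v_def)
    with elim show ?case using k by simp
  qed
qed

section \<open>Squares of rigid distances\<close>

lemma apollonius_midpoint:
  fixes x a b :: "'a::real_inner"
  shows "(norm (x - (1/2) *\<^sub>R (a + b)))\<^sup>2
    = ((norm (x - a))\<^sup>2 + (norm (x - b))\<^sup>2) / 2 - (norm (a - b))\<^sup>2 / 4"
  by (simp add: power2_norm_eq_inner inner_diff inner_add inner_commute field_simps)

text \<open>
  In an isosceles triangle with legs \<open>a\<close> and base \<open>2 b\<close> the altitude ends at the midpoint of the base.
  Midpoints are respected, so the length of the median is determined by the sides.
\<close>
lemma rigid_sqrt_diff:
  assumes n: "CARD('n::finite) > 1" and ab: "rigid TYPE('n) a" "rigid TYPE('n) b" "0 \<le> b" "b \<le> a"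
  shows "rigid TYPE('n) (sqrt (a\<^sup>2 - b\<^sup>2))"
proof -
  obtain w :: "real ^ 'n" where w: "norm w = b"
    using vector_choose_size[of b] ab(3) by auto
  have ww: "norm (w - (- w)) = real 2 * b" using w by (simp flip: scaleR_2)
  obtain x where x: "norm (x - w) = a" "norm (x - (- w)) = a"
    using isosceles_apex[of w "- w" a] n ww ab(4) by auto
  have sq: "norm (y - z) = sqrt (a\<^sup>2 - b\<^sup>2)"
    if "norm (y - p) = a" "norm (y - q) = a" "norm (p - q) = real 2 * b" "z = (1/2) *\<^sub>R (p + q)"
    for y z p q :: "real ^ 'n"
    unfolding that(4) using apollonius_midpoint[of y p q] that(1-3)
    by (simp add: power_mult_distrib real_sqrt_unique[symmetric])
  from rigidD[OF ab(1) x(1)] rigidD[OF ab(1) x(2)] rigidD[OF rigid_mult_nat[OF n ab(2,3)] ww]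
    eventually_reflect[OF n ab(2) w, of 0]
  have "\<forall>\<^sub>F f in unit_preserving. norm (f x - f 0) = sqrt (a\<^sup>2 - b\<^sup>2)"
  proof eventually_elim
    case (elim f)
    then have "f 0 = (1/2) *\<^sub>R (f w + f (- w))" by simp
    with elim show ?case by (intro sq[of _ "f w" "f (- w)"])
  qed
  then show ?thesis by (rule rigidI) (intro sq[OF x ww], simp)
qed

definition rigid_square :: "'n::finite itself \<Rightarrow> real \<Rightarrow> bool" where
  "rigid_square T e \<longleftrightarrow> e \<ge> 0 \<and> rigid T (sqrt e)"

lemma rigid_square_diff:
  assumes n: "CARD('n::finite) > 1" and "rigid_square TYPE('n) e" "rigid_square TYPE('n) e'" "e' \<le> e"
  shows "rigid_square TYPE('n) (e - e')"
  using rigid_sqrt_diff[OF n, of "sqrt e" "sqrt e'"] assms by (simp add: rigid_square_def)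

text \<open>
  Every natural number is a difference of two squares of half-integers, so differences are enough.
\<close>
lemma rigid_square_mult_nat:
  assumes n: "CARD('n::finite) > 1" and e: "rigid_square TYPE('n) e"
  shows "rigid_square TYPE('n) (real k * e)"
proof (cases "k = 0")
  case True
  then show ?thesis by (simp add: rigid_square_def rigid_0)
next
  case False
  have r: "rigid_square TYPE('n) ((real m / 2)\<^sup>2 * e)" for m
    using rigid_div_nat[OF n rigid_mult_nat[OF n, of "sqrt e" m], of 2] e
    by (simp add: rigid_square_def real_sqrt_mult)
  have "rigid_square TYPE('n) ((real (k + 1) / 2)\<^sup>2 * e - (real (k - 1) / 2)\<^sup>2 * e)"
    using e False by (intro rigid_square_diff n r mult_right_mono power_mono) (auto simp: rigid_square_def)
  also have "(real (k + 1) / 2)\<^sup>2 * e - (real (k - 1) / 2)\<^sup>2 * e = real k * e"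
    using False by (simp add: of_nat_diff power2_eq_square algebra_simps add_divide_distrib diff_divide_distrib)
  finally show ?thesis .
qed

text \<open>
  A sum is a difference, \<open>e + e' = (N + 1) e - (N e - e')\<close>, as soon as \<open>N e\<close> exceeds \<open>e'\<close>.
\<close>
lemma rigid_square_add:
  assumes n: "CARD('n::finite) > 1" and e: "rigid_square TYPE('n) e" "rigid_square TYPE('n) e'"
  shows "rigid_square TYPE('n) (e + e')"
proof (cases "e = 0")
  case False
  then have e0: "e > 0" "e' \<ge> 0" using e by (auto simp: rigid_square_def)
  obtain N where N: "e' < real N * e" using reals_Archimedean3[OF e0(1)] by blast
  have "rigid_square TYPE('n) (real (Suc N) * e - (real N * e - e'))"
    using N e0 by (intro rigid_square_diff rigid_square_mult_nat n e) (auto simp: algebra_simps)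
  then show ?thesis by (simp add: algebra_simps)
qed (use e in simp)

lemma rigid_square_power2:
  "rigid TYPE('n::finite) d \<Longrightarrow> d \<ge> 0 \<Longrightarrow> rigid_square TYPE('n) (d\<^sup>2)"
  by (simp add: rigid_square_def)

section \<open>Rigid distances along a line\<close>

text \<open>
  Lengths that are not known to be rigid still satisfy upper bounds, by a path of two rigid steps.
\<close>
lemma eventually_norm_le:
  fixes x y :: "real ^ 'n"
  assumes "CARD('n) > 1" "rigid TYPE('n) s" "norm (x - y) \<le> 2 * s"
  shows "\<forall>\<^sub>F f in unit_preserving. norm (f x - f y) \<le> 2 * s"
proof -
  obtain m where m: "norm (m - x) = s" "norm (m - y) = s"
    using isosceles_apex assms(1,3) by blast
  from rigidD[OF assms(2) m(1)] rigidD[OF assms(2) m(2)] show ?thesis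
  proof eventually_elim
    case (elim f)
    then show ?case using norm_triangle_ineq4[of "f m - f y" "f m - f x"] by simp
  qed
qed

text \<open>
  Sums of rigid squares are rigid squares, so by Pythagoras the right angles between the coordinate
  axes are kept. Hence, seen from the image of the origin, the images of the unit vectors form an
  orthonormal frame, and the image of \<open>axis i a\<close>, being orthogonal to all but one of its members, lies
  on the line of that one.
\<close>
lemma eventually_axis_line:
  assumes n: "CARD('n::finite) > 1" and a: "rigid TYPE('n) a" "a \<ge> 0"
  shows "\<forall>\<^sub>F f in unit_preserving. norm (f (axis i a) - f 0 :: real ^ 'n) = a \<and>
    (\<exists>t. f (axis i a) = f 0 + t *\<^sub>R (f (axis i 1) - f 0))"
proof -
  have ax: "norm (axis j b - axis k c :: real ^ 'n) = sqrt (b\<^sup>2 + c\<^sup>2)" if "j \<noteq> k" for j k b c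
    using that by (simp add: norm_eq_sqrt_inner inner_diff inner_axis_axis inner_commute power2_eq_square)
  have ax0: "norm (axis j b - 0 :: real ^ 'n) = \<bar>b\<bar>" for j b
    by (simp add: norm_eq_sqrt_inner inner_axis_axis)
  have r2: "rigid TYPE('n) (sqrt (1\<^sup>2 + 1\<^sup>2))" and ra: "rigid TYPE('n) (sqrt (a\<^sup>2 + 1\<^sup>2))"
    using rigid_square_add[OF n rigid_square_power2 rigid_square_power2] a rigid_1 
    unfolding rigid_square_def by force+
  have "\<forall>\<^sub>F f in unit_preserving. \<forall>j k. j \<noteq> k \<longrightarrow>
      norm (f (axis j 1) - f (axis k 1) :: real ^ 'n) = sqrt (1\<^sup>2 + 1\<^sup>2)"
    using rigidD[OF r2] ax by (intro eventually_all_finite) (auto simp del: one_power2)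
  moreover have "\<forall>\<^sub>F f in unit_preserving. \<forall>j. norm (f (axis j 1) - f 0 :: real ^ 'n) = 1"
    by (intro eventually_all_finite rigidD[OF rigid_1]) (simp only: ax0 abs_one)
  moreover have "\<forall>\<^sub>F f in unit_preserving. \<forall>k. i \<noteq> k \<longrightarrow>
      norm (f (axis i a) - f (axis k 1) :: real ^ 'n) = sqrt (a\<^sup>2 + 1\<^sup>2)"
    using rigidD[OF ra] ax by (intro eventually_all_finite) (auto simp del: one_power2)
  moreover have "\<forall>\<^sub>F f in unit_preserving. norm (f (axis i a) - f 0 :: real ^ 'n) = a"
    using rigidD[OF a(1)] ax0 a(2) by auto
  ultimately show ?thesis
  proof eventually_elim
    case (elim f)
    define g where "g j = f (axis j 1) - f 0" for j
    define h where "h = f (axis i a) - f 0"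
    have pyth: "2 * (v \<bullet> w) = (norm v)\<^sup>2 + (norm w)\<^sup>2 - (norm (v - w))\<^sup>2" for v w :: "real ^ 'n"
      by (simp add: power2_norm_eq_inner inner_diff inner_commute)
    have d: "f x - f 0 - (f y - f 0) = f x - f y" for x y by simp
    have gg: "g j \<bullet> g k = 0 + (if j = k then 1 else 0)" for j k
      using elim(1,2) pyth[of "g j" "g k"] unfolding g_def d by (auto simp flip: power2_norm_eq_inner)
    have hg: "h \<bullet> g k = 0" if "k \<noteq> i" for k
      using elim(2,3,4) that pyth[of h "g k"] unfolding g_def h_def d by auto
    have "h - (h \<bullet> g i) *\<^sub>R g i = 0"
      by (rule orthogonal_gram_imp_zero[of g 0 1]) (auto simp: gg hg inner_diff_left)
    then have "f (axis i a) = f 0 + (h \<bullet> g i) *\<^sub>R (f (axis i 1) - f 0)"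
      by (simp add: h_def g_def algebra_simps)
    then show ?case using elim(4) by blast
  qed
qed

text \<open>
  The image of \<open>a e\<close> is at distance \<open>a\<close> from the image of the origin, on the image of the line, so only
  its side is in doubt. A rational \<open>r\<close> with \<open>a / 2 < r < a\<close> decides: the image of \<open>r e\<close> is known, and the
  image of \<open>a e\<close> is within \<open>2 r < a + r\<close> of it, which the wrong side would violate.
\<close>
lemma homothetic_rigid_length:
  assumes n: "CARD('n::finite) > 1" and a: "rigid TYPE('n) a" "a > 0"
  shows "homothetic TYPE('n) 1 a"
proof -
  fix i :: 'n
  define e :: "real ^ 'n" where "e = axis i 1"
  have e: "norm e = 1" "a *\<^sub>R e = axis i a"
    by (simp_all add: e_def) (simp add: axis_def vec_eq_iff)
  obtain r where r: "r \<in> \<rat>" "a / 2 < r" "r < a" using Rats_dense_in_real[of "a / 2" a] a(2) by auto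
  then obtain j k :: nat where jk: "k \<noteq> 0" "\<bar>r\<bar> = real j / real k"
    by (meson Rats_abs_nat_div_natE)
  then have jk: "k > 0" "r = real j / real k" using r a(2) by auto
  have h: "homothetic TYPE('n) 1 r" unfolding jk(2) by (rule homothetic_rational[OF n rigid_1 jk(1)])
  have "rigid TYPE('n) r" using rigid_of_homothetic[OF h rigid_1] r a(2) by simp
  moreover have "norm (a *\<^sub>R e - r *\<^sub>R e) \<le> 2 * r"
    using r e(1) by (simp flip: scaleR_diff_left)
  ultimately have "\<forall>\<^sub>F f in unit_preserving. norm (f (a *\<^sub>R e) - f (r *\<^sub>R e)) \<le> 2 * r"
    by (rule eventually_norm_le[OF n])
  moreover have "norm (e - 0) = 1" using e(1) by simp
  note rigidD[OF rigid_1 this]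
  ultimately have base: "\<forall>\<^sub>F f in unit_preserving. f (a *\<^sub>R e) = f 0 + a *\<^sub>R (f e - f 0)"
    using homotheticD[OF h e(1), of 0] eventually_axis_line[OF n a(1) less_imp_le[OF a(2)], of i]
  proof eventually_elim
    case (elim f)
    obtain t where t: "f (a *\<^sub>R e) = f 0 + t *\<^sub>R (f e - f 0)" and "norm (f (a *\<^sub>R e) - f 0) = a"
      using elim(4) unfolding e(2)[symmetric] e_def[symmetric] by blast
    then have "\<bar>t\<bar> = a" using elim(2) by simp
    moreover have "f (a *\<^sub>R e) - f (r *\<^sub>R e) = (t - r) *\<^sub>R (f e - f 0)"
      using t elim(3) by (simp add: algebra_simps)
    then have "\<bar>t - r\<bar> \<le> 2 * r" using elim(1,2) by simp
    ultimately have "t = a" using r by linarith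
    then show ?case using t by simp
  qed
  \<comment> \<open>an isometry carries the axis to an arbitrary line\<close>
  show ?thesis
    unfolding homothetic_def
  proof (intro allI impI)
    fix p u :: "real ^ 'n"
    assume u: "norm u = 1"
    have "norm (0 - e) = norm (p - (p + u))" using u e by simp
    then obtain g where g: "\<And>x y. norm (g x - g y) = norm (x - y)" "g 0 = p" "g e = p + u"
      "\<And>c b. g (0 + c *\<^sub>R b) = p + c *\<^sub>R (g (0 + b) - p)"
      by (rule isometry_between_pairs) blast
    show "\<forall>\<^sub>F f in unit_preserving. f (p + a *\<^sub>R u) = f p + a *\<^sub>R (f (p + u) - f p)"
      using eventually_compose_isometry[OF base g(1)] g(2,3) g(4)[of a e] by simp
  qed
qed

lemma eventually_signed_line:
  fixes p u :: "real ^ 'n"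
  assumes n: "CARD('n) > 1" and a: "rigid TYPE('n) \<bar>a\<bar>" and u: "norm u = 1"
  shows "\<forall>\<^sub>F f in unit_preserving. f (p + a *\<^sub>R u) = f p + a *\<^sub>R (f (p + u) - f p)"
proof (cases a "0 :: real" rule: linorder_cases)
  case greater
  then show ?thesis using homotheticD[OF homothetic_rigid_length[OF n a] u] by simp
next
  case less
  have u': "norm (- u) = 1" using u by simp
  have "\<forall>\<^sub>F f in unit_preserving. f (p + \<bar>a\<bar> *\<^sub>R (- u)) = f p + \<bar>a\<bar> *\<^sub>R (f (p + - u) - f p)"
    using homotheticD[OF homothetic_rigid_length[OF n a] u'] less by simp
  then show ?thesis using eventually_reflect[OF n rigid_1 u, of p]
  proof eventually_elim
    case (elim f)
    have e: "f (p - u) - f p = - (f (p + u) - f p)" using elim(2) by (simp add: algebra_simps scaleR_2)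
    have "p + \<bar>a\<bar> *\<^sub>R (- u) = p + a *\<^sub>R u" "p + - u = p - u" using less by simp_all
    with elim(1) have "f (p + a *\<^sub>R u) = f p + \<bar>a\<bar> *\<^sub>R (f (p - u) - f p)" by metis
    then show ?case unfolding e using less by (simp add: scaleR_diff_right)
  qed
qed simp

lemma rigid_abs_diff:
  assumes n: "CARD('n::finite) > 1" and ab: "rigid TYPE('n) \<bar>a\<bar>" "rigid TYPE('n) \<bar>b\<bar>"
  shows "rigid TYPE('n) \<bar>a - b\<bar>"
proof -
  obtain u :: "real ^ 'n" where u: "norm u = 1"
    using vector_choose_size[of 1] by auto
  then have u': "norm (0 + u - 0) = 1" by simp
  from eventually_signed_line[OF n ab(1) u, of 0] eventually_signed_line[OF n ab(2) u, of 0]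
    rigidD[OF rigid_1 u']
  have "\<forall>\<^sub>F f in unit_preserving. norm (f (0 + a *\<^sub>R u) - f (0 + b *\<^sub>R u)) = \<bar>a - b\<bar>"
  proof eventually_elim
    case (elim f)
    have "f (0 + a *\<^sub>R u) - f (0 + b *\<^sub>R u) = (a - b) *\<^sub>R (f (0 + u) - f 0)"
      unfolding elim(1,2) by (simp add: algebra_simps)
    then show ?case using elim(3) by simp
  qed
  then show ?thesis by (rule rigidI) (use u in \<open>simp flip: scaleR_diff_left\<close>)
qed

section \<open>The field of rigid distances\<close>

text \<open>
  Long vectors are needed as well, since a base \<open>b\<close> fits on legs \<open>L\<close> only if \<open>b \<le> 2 L\<close>.
\<close>
lemma homothetic_nat_length:
  assumes n: "CARD('n::finite) > 1" and a: "rigid TYPE('n) a" "a > 0" and N: "N > 0"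
  shows "homothetic TYPE('n) (real N) a"
  unfolding homothetic_def
proof (intro allI impI)
  fix p u :: "real ^ 'n"
  assume u: "norm u = real N"
  define e where "e = (1 / real N) *\<^sub>R u"
  have e: "norm e = 1" "u = real N *\<^sub>R e" using u N by (simp_all add: e_def)
  have "homothetic TYPE('n) 1 (real N * a)"
    using rigid_mult_nat[OF n a(1), of N] a(2) N by (intro homothetic_rigid_length[OF n]) simp_all
  note homotheticD[OF this e(1), of p] homotheticD[OF homothetic_of_nat[OF n rigid_1] e(1), of p N]
  then show "\<forall>\<^sub>F f in unit_preserving. f (p + a *\<^sub>R u) = f p + a *\<^sub>R (f (p + u) - f p)"
    by eventually_elim (simp add: e(2) mult.commute)
qed

text \<open>
  The two directions give products and, with \<open>b = 1 / a\<close>, inverses.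
\<close>
lemma rigid_mult_iff:
  assumes n: "CARD('n::finite) > 1" and a: "rigid TYPE('n) a" "a > 0" and "b \<ge> 0"
  shows "rigid TYPE('n) (a * b) \<longleftrightarrow> rigid TYPE('n) b"
proof -
  obtain N where N: "b < real N" using reals_Archimedean2 by blast
  then have "N > 0" using \<open>b \<ge> 0\<close> by (cases N) auto
  then show ?thesis
    using homothetic_thales[OF n homothetic_nat_length[OF n a], of N b] N assms(3,4) by simp
qed

text \<open>
  This rests on \<open>4 a = (a + 1)\<^sup>2 - (a - 1)\<^sup>2\<close>.
\<close>
lemma rigid_sqrt:
  assumes n: "CARD('n::finite) > 1" and a: "rigid TYPE('n) a" "a \<ge> 0"
  shows "rigid TYPE('n) (sqrt a)"
proof -
  have "rigid TYPE('n) \<bar>a - (- 1)\<bar>" "rigid TYPE('n) \<bar>a - 1\<bar>"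
    using rigid_abs_diff[OF n, of a "- 1"] rigid_abs_diff[OF n, of a 1] a by (simp_all add: rigid_1)
  then have "rigid TYPE('n) (sqrt (\<bar>a - (- 1)\<bar>\<^sup>2 - \<bar>a - 1\<bar>\<^sup>2))"
    using a(2) by (intro rigid_sqrt_diff[OF n]) auto
  also have "\<bar>a - (- 1)\<bar>\<^sup>2 - \<bar>a - 1\<bar>\<^sup>2 = 2\<^sup>2 * a" by (simp add: power2_eq_square algebra_simps)
  finally have "rigid TYPE('n) (2 * sqrt a)" by (simp add: real_sqrt_mult)
  then show ?thesis using rigid_div_nat[OF n, of "2 * sqrt a" 2] a(2) by simp
qed

lemma real_subfield_rigid:
  assumes n: "CARD('n::finite) > 1"
  shows "real_subfield {r. rigid TYPE('n) \<bar>r\<bar>}"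
  unfolding real_subfield_def mem_Collect_eq Ball_def
proof (intro conjI allI impI)
  show "rigid TYPE('n) \<bar>a + b\<bar>" if "rigid TYPE('n) \<bar>a\<bar>" "rigid TYPE('n) \<bar>b\<bar>" for a b
    using rigid_abs_diff[OF n, of a "- b"] that by simp
  show "rigid TYPE('n) \<bar>a * b\<bar>" if "rigid TYPE('n) \<bar>a\<bar>" "rigid TYPE('n) \<bar>b\<bar>" for a b
    using rigid_mult_iff[OF n, of "\<bar>a\<bar>" "\<bar>b\<bar>"] that by (cases "a = 0") (auto simp: abs_mult)
  show "rigid TYPE('n) \<bar>inverse a\<bar>" if "rigid TYPE('n) \<bar>a\<bar>" "a \<noteq> 0" for a
    using rigid_mult_iff[OF n, of "\<bar>a\<bar>" "\<bar>inverse a\<bar>"] that by (simp add: rigid_1 flip: abs_mult)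
qed (simp_all add: rigid_0 rigid_1)

lemma sqrt_closed_rigid:
  assumes n: "CARD('n::finite) > 1"
  shows "sqrt_closed {r. rigid TYPE('n) \<bar>r\<bar>}"
  using rigid_sqrt[OF n] by (auto simp: sqrt_closed_def)

theorem theorem1:
  fixes x y :: "real ^ 'n"
  assumes "CARD('n) > 1"
    and "constructible (norm (x - y))"
  shows "\<exists>S :: (real ^ 'n) set. finite S \<and> x \<in> S \<and> y \<in> S \<and>
           (\<forall>f :: real ^ 'n \<Rightarrow> real ^ 'n.
              preserves_unit_distance_on S f \<longrightarrow> norm (f x - f y) = norm (x - y))"
proof -
  have "real_quadratic_closure \<subseteq> {r. rigid TYPE('n) \<bar>r\<bar>}"
    using assms(1) by (intro real_quadratic_closure_least real_subfield_rigid sqrt_closed_rigid)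
  then have "rigid TYPE('n) (norm (x - y))"
    using assms(2) by (auto simp: constructible_def)
  then obtain S :: "(real ^ 'n) set" where S: "finite S"
      "\<And>f. preserves_unit_distance_on S f \<Longrightarrow> norm (f x - f y) = norm (x - y)"
    using rigidD[of "norm (x - y)" x y] unfolding eventually_unit_preserving by blast
  have "norm (f x - f y) = norm (x - y)" if "preserves_unit_distance_on (insert x (insert y S)) f" for f
    using that by (intro S(2) preserves_unit_distance_on_mono[OF that]) auto
  then show ?thesis using S(1) by (intro exI[of _ "insert x (insert y S)"]) auto
qed

end
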